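(* Let $d\ge1$ and let $U$ be a unitary operator on $\mathbb C^d$. Consider the following procedure on $\mathcal H_c\otimes\mathcal H_t\otimes\mathcal H_a=\mathbb C^2\otimes\mathbb C^d\otimes\mathbb C^d$: prepare the state $|0\rangle\langle0|\otimes\frac{\mathbb I_d}{d}\otimes\frac{\mathbb I_d}{d}$, apply the Hadamard gate $\mathrm H$ to the control qubit $\mathcal H_c$, apply the unitary $W_U$ (defined in the context), and apply $\mathrm H$ to the control qubit again. Then the reduced density matrix of the control qubit is $$\tilde\rho_c=\tfrac12\left(\mathbb I_2+a_U^2\,\sigma_z\right),\qquad a_U=\frac{|\mathrm{Tr}[U]|}{d},$$ and hence the expectation value of $\sigma_z$ on the control qubit is $\mathrm{Tr}[\tilde\rho_c\sigma_z]=a_U^2=|\mathrm{Tr}[U]|^2/d^2$.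
   Context: $\mathrm H$ is the Hadamard gate, $\mathrm H|0\rangle=(|0\rangle+|1\rangle)/\sqrt2$, $\mathrm H|1\rangle=(|0\rangle-|1\rangle)/\sqrt2$, and $\sigma_z=|0\rangle\langle0|-|1\rangle\langle1|$. The controlled swap $C_S$ on $\mathbb C^2\otimes\mathbb C^d\otimes\mathbb C^d$ is the linear map with $C_S|0\rangle|\psi\rangle|\phi\rangle=|0\rangle|\phi\rangle|\psi\rangle$ and $C_S|1\rangle|\psi\rangle|\phi\rangle=|1\rangle|\psi\rangle|\phi\rangle$, and $W_U=C_S(\mathbb I_2\otimes U\otimes\mathbb I_d)C_S$. *)

theory Defs
  imports "HOL-Analysis.Analysis"
begin

text \<open>
  Operators are matrices in the computational basis: \<open>complex ^ 'n ^ 'm\<close> maps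
  \<open>complex ^ 'n\<close> to \<open>complex ^ 'm\<close>. The space \<open>\<complex>\<^sup>d\<close> is \<open>complex ^ 'd\<close> with
  \<open>d = CARD('d)\<close>, the control qubit is \<open>complex ^ 2\<close>, with the elements \<open>0\<close> and \<open>1\<close> of the
  index type \<open>2\<close> labelling its two basis states. Tensor products are indexed by pairs.
\<close>

definition tensor_vec :: "complex ^ 'm \<Rightarrow> complex ^ 'n \<Rightarrow> complex ^ ('m::finite \<times> 'n::finite)"
    (infixr "\<otimes>\<^sub>v" 75) where
  "v \<otimes>\<^sub>v w = (\<chi> p. v $ fst p * w $ snd p)"

definition tensor_mat ::
    "complex ^ 'n ^ 'm \<Rightarrow> complex ^ 'l ^ 'k \<Rightarrow>
      complex ^ ('n::finite \<times> 'l::finite) ^ ('m::finite \<times> 'k::finite)"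
    (infixr "\<otimes>\<^sub>m" 75) where
  "A \<otimes>\<^sub>m B = (\<chi> p q. A $ fst p $ fst q * B $ snd p $ snd q)"

definition conj_transpose :: "complex ^ 'n ^ 'm \<Rightarrow> complex ^ 'm ^ 'n" where
  "conj_transpose A = (\<chi> i j. cnj (A $ j $ i))"

definition unitary :: "complex ^ 'n ^ 'n \<Rightarrow> bool" where
  "unitary U \<longleftrightarrow> conj_transpose U ** U = mat 1 \<and> U ** conj_transpose U = mat 1"

definition ket :: "'n \<Rightarrow> complex ^ 'n" where
  "ket i = axis i 1"

definition outer :: "complex ^ 'm \<Rightarrow> complex ^ 'n \<Rightarrow> complex ^ 'n ^ 'm" where
  "outer v w = (\<chi> i j. v $ i * cnj (w $ j))"

definition hadamard :: "complex ^ 2 ^ 2" where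
  "hadamard =
     outer ((1 / sqrt 2) *\<^sub>R (ket 0 + ket 1)) (ket 0) +
     outer ((1 / sqrt 2) *\<^sub>R (ket 0 - ket 1)) (ket 1)"

definition sigma_z :: "complex ^ 2 ^ 2" where
  "sigma_z = outer (ket 0) (ket 0) - outer (ket 1) (ket 1)"

definition swap_mat :: "complex ^ ('d::finite \<times> 'd) ^ ('d \<times> 'd)" where
  "swap_mat = (\<chi> p q. if p = prod.swap q then 1 else 0)"

text \<open>The swap is triggered by the control state \<open>0\<close>, not \<open>1\<close>.\<close>

definition controlled_swap :: "complex ^ (2 \<times> 'd::finite \<times> 'd) ^ (2 \<times> 'd \<times> 'd)" where
  "controlled_swap = outer (ket 0) (ket 0) \<otimes>\<^sub>m swap_mat + outer (ket 1) (ket 1) \<otimes>\<^sub>m mat 1"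

definition W :: "complex ^ 'd ^ 'd \<Rightarrow> complex ^ (2 \<times> 'd::finite \<times> 'd) ^ (2 \<times> 'd \<times> 'd)" where
  "W U = controlled_swap ** (mat 1 \<otimes>\<^sub>m U \<otimes>\<^sub>m mat 1) ** controlled_swap"

definition evolve :: "complex ^ 'n ^ 'n \<Rightarrow> complex ^ 'n ^ 'n \<Rightarrow> complex ^ 'n ^ 'n" where
  "evolve A \<rho> = A ** \<rho> ** conj_transpose A"

definition partial_trace_snd :: "complex ^ ('m::finite \<times> 'n::finite) ^ ('m \<times> 'n) \<Rightarrow> complex ^ 'm ^ 'm" where
  "partial_trace_snd \<rho> = (\<chi> i j. \<Sum>k\<in>UNIV. \<rho> $ (i, k) $ (j, k))"

definition maximally_mixed :: "complex ^ 'd ^ 'd" where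
  "maximally_mixed = (1 / real CARD('d)) *\<^sub>R mat 1"

definition initial_state :: "complex ^ (2 \<times> 'd::finite \<times> 'd) ^ (2 \<times> 'd \<times> 'd)" where
  "initial_state = outer (ket 0) (ket 0) \<otimes>\<^sub>m maximally_mixed \<otimes>\<^sub>m maximally_mixed"

definition control_hadamard :: "complex ^ (2 \<times> 'd::finite \<times> 'd) ^ (2 \<times> 'd \<times> 'd)" where
  "control_hadamard = hadamard \<otimes>\<^sub>m mat 1 \<otimes>\<^sub>m mat 1"

definition final_state :: "complex ^ 'd ^ 'd \<Rightarrow> complex ^ (2 \<times> 'd::finite \<times> 'd) ^ (2 \<times> 'd \<times> 'd)" where
  "final_state U =
     evolve control_hadamard (evolve (W U) (evolve control_hadamard initial_state))"

definition control_state :: "complex ^ 'd ^ 'd \<Rightarrow> complex ^ 2 ^ 2" where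
  "control_state U = partial_trace_snd (final_state U)"

definition amplitude :: "complex ^ 'd ^ 'd \<Rightarrow> real" where
  "amplitude U = cmod (trace U) / real CARD('d)"

lemma sum_UNIV_prod:
  fixes f :: "'a::finite \<times> 'b::finite \<Rightarrow> complex"
  shows "sum f UNIV = (\<Sum>i\<in>UNIV. \<Sum>j\<in>UNIV. f (i, j))"
  by (simp add: sum.cartesian_product)

lemma tensor_mat_vec: "(A \<otimes>\<^sub>m B) *v (v \<otimes>\<^sub>v w) = (A *v v) \<otimes>\<^sub>v (B *v w)"
  by (simp add: vec_eq_iff tensor_mat_def tensor_vec_def matrix_vector_mult_def sum_UNIV_prod
      sum_product mult_ac)

lemma outer_ket_mult: "outer v (ket i) *v ket j = (if i = j then v else 0)"
proof -
  have "(\<Sum>l\<in>UNIV. v $ k * cnj (ket i $ l) * ket j $ l) = (if i = j then v $ k else 0)" for k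
  proof -
    have "(\<Sum>l\<in>UNIV. v $ k * cnj (ket i $ l) * ket j $ l)
        = (\<Sum>l\<in>UNIV. if l = j then (if i = j then v $ k else 0) else 0)"
      by (rule sum.cong) (auto simp: ket_def axis_def)
    then show ?thesis by simp
  qed
  then show ?thesis
    by (simp add: vec_eq_iff outer_def matrix_vector_mult_def)
qed

lemma hadamard_ket:
  "hadamard *v ket 0 = (1 / sqrt 2) *\<^sub>R (ket 0 + ket 1)"
  "hadamard *v ket 1 = (1 / sqrt 2) *\<^sub>R (ket 0 - ket 1)"
  by (simp_all add: hadamard_def matrix_vector_mult_add_rdistrib outer_ket_mult)

lemma swap_mat_tensor: "swap_mat *v (\<psi> \<otimes>\<^sub>v \<phi>) = \<phi> \<otimes>\<^sub>v \<psi>"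
proof -
  have "(\<Sum>q\<in>UNIV. (if p = prod.swap q then 1 else 0) * (\<psi> $ fst q * \<phi> $ snd q))
      = \<phi> $ fst p * \<psi> $ snd p" for p :: "'a \<times> 'a"
  proof -
    have "(\<Sum>q\<in>UNIV. (if p = prod.swap q then 1 else 0) * (\<psi> $ fst q * \<phi> $ snd q))
        = (\<Sum>q\<in>UNIV. if q = prod.swap p then \<psi> $ fst q * \<phi> $ snd q else 0)"
      by (rule sum.cong) auto
    then show ?thesis by (simp add: mult.commute)
  qed
  then show ?thesis
    by (simp add: vec_eq_iff swap_mat_def tensor_vec_def matrix_vector_mult_def)
qed

lemma zero_tensor_vec [simp]: "0 \<otimes>\<^sub>v w = 0"
  by (simp add: vec_eq_iff tensor_vec_def)

lemma controlled_swap_tensor: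
  "controlled_swap *v (ket 0 \<otimes>\<^sub>v \<psi> \<otimes>\<^sub>v \<phi>) = ket 0 \<otimes>\<^sub>v \<phi> \<otimes>\<^sub>v \<psi>"
  "controlled_swap *v (ket 1 \<otimes>\<^sub>v \<psi> \<otimes>\<^sub>v \<phi>) = ket 1 \<otimes>\<^sub>v \<psi> \<otimes>\<^sub>v \<phi>"
  by (simp_all add: controlled_swap_def matrix_vector_mult_add_rdistrib tensor_mat_vec
      outer_ket_mult swap_mat_tensor)

end

theory Submission
  imports Defs
begin

text \<open>
  Since \<open>swap (U \<otimes> 1) swap = 1 \<otimes> U\<close>, the operator \<open>W U\<close> is block diagonal in the control, with
  blocks \<open>A = 1 \<otimes> U\<close> and \<open>B = U \<otimes> 1\<close>. After the Hadamard gates the whole circuit is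
  \<open>Q\<^sub>0 \<otimes> A + Q\<^sub>1 \<otimes> B\<close>, where \<open>Q\<^sub>0, Q\<^sub>1\<close> project onto the two Hadamard basis states.
  Tracing out the last two factors, the diagonal terms carry the weight \<open>Tr 1 / d\<^sup>2 = 1\<close> and the
  cross terms carry \<open>Tr (U \<otimes> U\<^sup>\<dagger>) / d\<^sup>2 = \<bar>Tr U\<bar>\<^sup>2 / d\<^sup>2\<close>.
\<close>

text \<open>\<open>UNIV_2\<close> enumerates the type as 1 and 2; there 2 = 0, which yields the
  labels used for the control basis.\<close>

lemma UNIV_2_zero_one: "(UNIV :: 2 set) = {0, 1}"
proof -
  have "(2::2) = 0" by simp
  then show ?thesis by (auto simp: UNIV_2)
qed

lemma sum_2_zero_one: "sum f (UNIV :: 2 set) = f 0 + f 1"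
  by (simp add: UNIV_2_zero_one)

lemma all_2_zero_one: "(\<forall>i::2. P i) \<longleftrightarrow> P 0 \<and> P 1"
  by (metis UNIV_2_zero_one UNIV_I empty_iff insert_iff)

lemma tensor_mat_mult: "(A \<otimes>\<^sub>m B) ** (C \<otimes>\<^sub>m D) = (A ** C) \<otimes>\<^sub>m (B ** D)"
  by (simp add: vec_eq_iff tensor_mat_def matrix_matrix_mult_def sum_UNIV_prod sum_product mult_ac)

lemma conj_transpose_tensor_mat:
  "conj_transpose (A \<otimes>\<^sub>m B) = conj_transpose A \<otimes>\<^sub>m conj_transpose B"
  by (simp add: vec_eq_iff tensor_mat_def conj_transpose_def)

lemma conj_transpose_add: "conj_transpose (A + B) = conj_transpose A + conj_transpose B"
  by (simp add: vec_eq_iff conj_transpose_def)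

lemma conj_transpose_one: "conj_transpose (mat 1) = mat 1"
  by (auto simp: vec_eq_iff conj_transpose_def mat_def)

lemma conj_transpose_mult:
  fixes A :: "complex ^ 'n::finite ^ 'm::finite" and B :: "complex ^ 'k::finite ^ 'n"
  shows "conj_transpose (A ** B) = conj_transpose B ** conj_transpose A"
  by (simp add: vec_eq_iff conj_transpose_def matrix_matrix_mult_def mult.commute)

lemma evolve_mult:
  fixes A B \<rho> :: "complex ^ 'n::finite ^ 'n"
  shows "evolve A (evolve B \<rho>) = evolve (A ** B) \<rho>"
  by (simp add: evolve_def conj_transpose_mult matrix_mul_assoc)

lemma trace_conj_transpose:
  fixes A :: "complex ^ 'n::finite ^ 'n"
  shows "trace (conj_transpose A) = cnj (trace A)"
  by (simp add: trace_def conj_transpose_def)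

lemma trace_tensor_mat: "trace (A \<otimes>\<^sub>m B) = trace A * trace B"
  by (simp add: trace_def tensor_mat_def sum_UNIV_prod sum_product)

lemma partial_trace_snd_add:
  "partial_trace_snd (A + B) = partial_trace_snd A + partial_trace_snd B"
  by (simp add: vec_eq_iff partial_trace_snd_def sum.distrib)

lemma partial_trace_snd_tensor:
  "partial_trace_snd (A \<otimes>\<^sub>m B) = (\<chi> i j. A $ i $ j * trace B)"
  by (simp add: vec_eq_iff partial_trace_snd_def tensor_mat_def trace_def sum_distrib_left)

text \<open>\<open>swap_mat\<close> is a permutation matrix: on the left it swaps the row index
  pair, on the right the column index pair, so the tensor factors change places.\<close>

lemma swap_mat_conjugate:
  fixes A B :: "complex ^ 'd::finite ^ 'd"
  shows "swap_mat ** (A \<otimes>\<^sub>m B) ** swap_mat = B \<otimes>\<^sub>m A"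
proof -
  \<comment> \<open>Solves the Kronecker delta for the summation index, so that the sum in
    \<open>left\<close> collapses.\<close>
  have swap_iff: "p = prod.swap q \<longleftrightarrow> q = prod.swap p" for p q :: "'d \<times> 'd"
    by auto
  have left: "(swap_mat ** C) $ p $ q = C $ prod.swap p $ q"
    for C :: "complex ^ ('d \<times> 'd) ^ ('d \<times> 'd)" and p q
    by (simp add: swap_mat_def matrix_matrix_mult_def swap_iff[of p] if_distrib[of "\<lambda>x. x * _"]
        cong: if_cong)
  have right: "(C ** swap_mat) $ p $ q = C $ p $ prod.swap q"
    for C :: "complex ^ ('d \<times> 'd) ^ ('d \<times> 'd)" and p q
    by (simp add: swap_mat_def matrix_matrix_mult_def if_distrib[of "\<lambda>x. _ * x"] cong: if_cong)
  have "(swap_mat ** (A \<otimes>\<^sub>m B) ** swap_mat) $ p $ q = (B \<otimes>\<^sub>m A) $ p $ q" for p q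
    unfolding left right by (simp add: tensor_mat_def)
  then show ?thesis
    by (simp add: vec_eq_iff)
qed

lemma outer_ket_mult_outer_ket:
  fixes i j k l :: "'n::finite"
  shows "outer (ket i) (ket j) ** outer (ket k) (ket l) = (if j = k then outer (ket i) (ket l) else 0)"
  by (auto simp: vec_eq_iff outer_def ket_def axis_def matrix_matrix_mult_def
      if_distrib[of cnj] if_distrib[of "\<lambda>x. x * _"] cong: if_cong)

lemma zero_tensor_mat: "0 \<otimes>\<^sub>m B = 0"
  by (simp add: vec_eq_iff tensor_mat_def)

lemma matrix_add_rdistrib:
  fixes A B :: "complex ^ 'n::finite ^ 'm"
  shows "(A + B) ** C = A ** C + B ** C"
  by (simp add: vec_eq_iff matrix_matrix_mult_def distrib_right sum.distrib)

text \<open>The control projectors are orthogonal, so mixed products vanish; in the block of control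
  0 the two swaps move \<open>U\<close> to the other factor.\<close>

lemma W_block_diagonal:
  "W U = outer (ket 0) (ket 0) \<otimes>\<^sub>m (mat 1 \<otimes>\<^sub>m U) + outer (ket 1) (ket 1) \<otimes>\<^sub>m (U \<otimes>\<^sub>m mat 1)"
  unfolding W_def controlled_swap_def
  by (simp add: matrix_add_ldistrib matrix_add_rdistrib tensor_mat_mult
      outer_ket_mult_outer_ket swap_mat_conjugate zero_tensor_mat)

lemma hadamard_matrix:
  "hadamard = (\<chi> i j. if i = 1 \<and> j = 1 then - complex_of_real (1 / sqrt 2)
    else complex_of_real (1 / sqrt 2))"
  by (simp add: vec_eq_iff all_2_zero_one hadamard_def outer_def ket_def axis_def scaleR_conv_of_real[where 'a=complex])

text \<open>As \<open>hadamard\<close> is self-adjoint, this is the projector onto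
  \<open>hadamard *v ket k\<close>.\<close>

definition hadamard_proj :: "2 \<Rightarrow> complex ^ 2 ^ 2" where
  "hadamard_proj k = hadamard ** outer (ket k) (ket k) ** hadamard"

lemma hadamard_proj_nth: "hadamard_proj k $ i $ j = (if k = 0 \<or> i = j then 1 / 2 else - 1 / 2)"
proof -
  have h: "complex_of_real (sqrt 2) * complex_of_real (sqrt 2) = 2"
    by (simp flip: of_real_mult)
  \<comment> \<open>Explicit quantifiers let \<open>all_2_zero_one\<close> split the claim into
    eight numerical cases.\<close>
  have "\<forall>k i j. hadamard_proj k $ i $ j = (if k = 0 \<or> i = j then 1 / 2 else - 1 / 2)"
    by (simp add: all_2_zero_one hadamard_proj_def hadamard_matrix matrix_matrix_mult_def
        sum_2_zero_one outer_def ket_def axis_def h)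
  then show ?thesis by blast
qed

lemma circuit_eq:
  "control_hadamard ** W U ** control_hadamard
    = hadamard_proj 0 \<otimes>\<^sub>m (mat 1 \<otimes>\<^sub>m U) + hadamard_proj 1 \<otimes>\<^sub>m (U \<otimes>\<^sub>m mat 1)"
  unfolding control_hadamard_def W_block_diagonal hadamard_proj_def
  by (simp add: matrix_add_ldistrib matrix_add_rdistrib tensor_mat_mult)

lemma maximally_mixed_tensor:
  "(maximally_mixed :: complex ^ 'd::finite ^ 'd) \<otimes>\<^sub>m (maximally_mixed :: complex ^ 'd ^ 'd)
    = (1 / (real CARD('d))\<^sup>2) *\<^sub>R mat 1"
  by (auto simp: vec_eq_iff tensor_mat_def maximally_mixed_def mat_def power2_eq_square
      scaleR_conv_of_real[where 'a=complex])

text \<open>Lets the maximally mixed state drop out of a trace, leaving only its scalar.\<close>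

lemma trace_scaleR_mid:
  fixes A :: "complex ^ 'n::finite ^ 'm::finite"
  shows "trace (A ** (c *\<^sub>R mat 1) ** B) = c *\<^sub>R trace (A ** B)"
proof -
  have "A ** (c *\<^sub>R mat 1) ** B = c *\<^sub>R (A ** B)"
    by (metis matrix_mul_rid matrix_scalar_ac scalar_matrix_assoc)
  then show ?thesis
    by (simp add: trace_def scaleR_sum_right)
qed

lemma control_state_eq:
  fixes U :: "complex ^ 'd::finite ^ 'd"
  assumes "unitary U"
  shows "control_state U = (1 / 2) *\<^sub>R (mat 1 + (amplitude U)\<^sup>2 *\<^sub>R sigma_z)"
proof -
  let ?A = "mat 1 \<otimes>\<^sub>m U" and ?B = "U \<otimes>\<^sub>m mat 1"
  let ?P = "outer (ket (0::2)) (ket 0)"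
  define M :: "complex ^ ('d \<times> 'd) ^ ('d \<times> 'd)" where "M = maximally_mixed \<otimes>\<^sub>m maximally_mixed"
  define a where "a = complex_of_real ((amplitude U)\<^sup>2)"
  have U: "U ** conj_transpose U = mat 1"
    using assms by (simp add: unitary_def)
  have M: "trace (C ** M ** D) = (1 / (real CARD('d))\<^sup>2) *\<^sub>R trace (C ** D)" for C D
    unfolding M_def maximally_mixed_tensor by (rule trace_scaleR_mid)
  have one: "trace (mat 1 :: complex ^ 'd ^ 'd) = of_nat CARD('d)"
    by (simp add: trace_def mat_def)
  have a: "a = trace U * cnj (trace U) / (of_nat CARD('d))\<^sup>2"
    by (simp add: a_def amplitude_def power_divide flip: complex_norm_square)
  \<comment> \<open>Unitarity enters here: both products reduce to the identity, whose trace cancels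
    the normalisation of \<open>M\<close>.\<close>
  have diag: "trace (?A ** M ** conj_transpose ?A) = 1" "trace (?B ** M ** conj_transpose ?B) = 1"
    by (simp_all add: M conj_transpose_tensor_mat conj_transpose_one tensor_mat_mult U
        trace_tensor_mat one scaleR_conv_of_real[where 'a=complex] power2_eq_square)
  \<comment> \<open>The products are \<open>U\<close> tensored with its adjoint, in either order, so
    the trace factors into Tr U times its conjugate.\<close>
  have cross: "trace (?A ** M ** conj_transpose ?B) = a" "trace (?B ** M ** conj_transpose ?A) = a"
    by (simp_all add: M conj_transpose_tensor_mat conj_transpose_one tensor_mat_mult
        trace_tensor_mat trace_conj_transpose a scaleR_conv_of_real[where 'a=complex] mult.commute)
  have "final_state U = evolve (control_hadamard ** W U ** control_hadamard) (?P \<otimes>\<^sub>m M)"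
    by (simp add: final_state_def evolve_mult initial_state_def M_def matrix_mul_assoc)
  then have "control_state U =
      (\<chi> i j. (hadamard_proj 0 ** ?P ** conj_transpose (hadamard_proj 0)) $ i $ j)
    + (\<chi> i j. (hadamard_proj 1 ** ?P ** conj_transpose (hadamard_proj 1)) $ i $ j)
    + (\<chi> i j. (hadamard_proj 0 ** ?P ** conj_transpose (hadamard_proj 1)) $ i $ j * a)
    + (\<chi> i j. (hadamard_proj 1 ** ?P ** conj_transpose (hadamard_proj 0)) $ i $ j * a)"
    \<comment> \<open>The instantiations with \<open>hadamard_proj\<close> split off the control
      factor only, keeping \<open>?A\<close>, \<open>?B\<close> and \<open>M\<close> intact for
      \<open>diag\<close> and \<open>cross\<close>.\<close>
    by (simp add: control_state_def circuit_eq evolve_def conj_transpose_add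
        conj_transpose_tensor_mat[of "hadamard_proj _"] matrix_add_ldistrib matrix_add_rdistrib
        tensor_mat_mult[of "hadamard_proj _"] tensor_mat_mult[of "hadamard_proj _ ** _"]
        partial_trace_snd_add partial_trace_snd_tensor diag cross add_ac)
  \<comment> \<open>Entrywise, the first two matrices sum to half the identity and the last two to
    \<open>a\<close> / 2 times \<open>sigma_z\<close>.\<close>
  also have "\<dots> = (1 / 2) *\<^sub>R (mat 1 + (amplitude U)\<^sup>2 *\<^sub>R sigma_z)"
    by (simp add: vec_eq_iff all_2_zero_one matrix_matrix_mult_def sum_2_zero_one
        conj_transpose_def hadamard_proj_nth outer_def ket_def axis_def mat_def sigma_z_def
        scaleR_conv_of_real[where 'a=complex] a_def)
  finally show ?thesis .
qed

theorem mainTheorem3: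
  fixes U :: "complex ^ 'd ^ 'd"
  assumes "unitary U"
  shows "control_state U = (1 / 2) *\<^sub>R (mat 1 + (amplitude U)\<^sup>2 *\<^sub>R sigma_z)
    \<and> trace (control_state U ** sigma_z) = complex_of_real ((amplitude U)\<^sup>2)
    \<and> (amplitude U)\<^sup>2 = (cmod (trace U))\<^sup>2 / (real CARD('d))\<^sup>2"
proof (intro conjI)
  show eq: "control_state U = (1 / 2) *\<^sub>R (mat 1 + (amplitude U)\<^sup>2 *\<^sub>R sigma_z)"
    using assms by (rule control_state_eq)
  \<comment> \<open>\<open>sigma_z\<close> has trace 0 and its square has trace 2, which cancels the
    factor 1/2.\<close>
  show "trace (control_state U ** sigma_z) = complex_of_real ((amplitude U)\<^sup>2)"
    unfolding eq
    by (simp add: trace_def matrix_matrix_mult_def sum_2_zero_one sigma_z_def outer_def ket_def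
        axis_def mat_def scaleR_conv_of_real[where 'a=complex] field_simps)
  show "(amplitude U)\<^sup>2 = (cmod (trace U))\<^sup>2 / (real CARD('d))\<^sup>2"
    by (simp add: amplitude_def power_divide)
qed

end
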